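(* For a Tychonoff space $X$ the following conditions are equivalent: (a) $X$ has a remote point; (b) there exists a zero-cozero-closed-open ultrafilter on $X$ with no accumulation points; (c) there exists a non-principal ultrafilter $u$ on $X$ such that $\mathrm{Op}(u)=\mathrm{Cl}(u)=\mathrm{Z}(u)=\mathrm{Cz}(u)$; (d) $X$ is not weakly $\mathrm{NF}$-compact.
   Context: A filter on a set $X$ is a nonempty family of subsets of $X$ not containing $\emptyset$ and closed under finite intersections and supersets; an ultrafilter on $X$ is a maximal filter. For a property $R$ of subsets of a space $X$: a filter $\mathcal F$ on $X$ is an $R$ filter if it has a base consisting of sets with property $R$; it is an $R$ ultrafilter if it is an $R$ filter and for every $A\subseteq X$ with property $R$ either $A\in\mathcal F$ or $X\setminus A\in\mathcal F$. An $R_0$-$\cdots$-$R_n$ (ultra)filter is a filter that is simultaneously an $R_i$ (ultra)filter for each $i\le n$. The properties used are: open, closed, zero ($A=f^{-1}(0)$ for some continuous $f\colon X\to[0,1]$), cozero (complement of a zero set). A point $x\in X$ is an accumulation point of a filter $\mathcal F$ on $X$ if $x\in\bigcap_{F\in\mathcal F}\overline F$. For an ultrafilter $u$ on $X$, $\mathrm{Op}(u)$, $\mathrm{Cl}(u)$, $\mathrm{Z}(u)$, $\mathrm{Cz}(u)$ denote the filters on $X$ generated by all elements of $u$ that are, respectively, open, closed, zero, cozero subsets of $X$. For a Tychonoff space $X$, $\beta(X)$ is the Stone–Čech compactification and $X^*=\beta(X)\setminus X$. A point $p\in X^*$ is remote if $p$ is not in the closure (in $\beta(X)$) of any nowhere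 dense subset of $X$. $X$ has a remote point if some $p\in X^*$ is remote. $\mathrm{NF}$ is the ideal on $X$ generated by all nowhere dense subsets of $X$ together with all finite subsets of $X$ (i.e. all sets $N\cup F$ with $N$ nowhere dense and $F$ finite). For an ideal $J$ on $X$, the space $X$ is weakly $J$-compact if for each function $\phi$ from $J$ to the family of cozero subsets of $X$, such that for each $A\in J$ there exists a zero set $Z_A$ with $A\subseteq Z_A\subseteq\phi(A)$, there exists a finite family $\mathcal A\subseteq J$ with $\bigcup_{A\in\mathcal A}\phi(A)=X$. *)

theory Defs
  imports "HOL-Analysis.Analysis"
begin

section \<open>Tychonoff spaces; zero and cozero sets\<close>

definition tychonoff_space :: "'a topology \<Rightarrow> bool" where
  "tychonoff_space X \<longleftrightarrow> completely_regular_space X \<and> Hausdorff_space X"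

definition zero_set :: "'a topology \<Rightarrow> 'a set \<Rightarrow> bool" where
  "zero_set X A \<longleftrightarrow>
     (\<exists>f. continuous_map X (top_of_set {0..1::real}) f \<and> A = {x \<in> topspace X. f x = 0})"

definition cozero_set :: "'a topology \<Rightarrow> 'a set \<Rightarrow> bool" where
  "cozero_set X A \<longleftrightarrow> A \<subseteq> topspace X \<and> zero_set X (topspace X - A)"

definition nowhere_dense_in :: "'a topology \<Rightarrow> 'a set \<Rightarrow> bool" where
  "nowhere_dense_in X N \<longleftrightarrow> N \<subseteq> topspace X \<and> X interior_of (X closure_of N) = {}"


section \<open>Filters on a set, as families of subsets\<close>

text \<open>The type \<^typ>\<open>'a filter\<close> is not used: its filters may be improper and live on a whole type,
  whereas here filters are proper and live on the carrier of a topology.\<close>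

definition filter_on :: "'a set \<Rightarrow> 'a set set \<Rightarrow> bool" where
  "filter_on S F \<longleftrightarrow>
     F \<noteq> {} \<and> F \<subseteq> Pow S \<and> {} \<notin> F \<and>
     (\<forall>A\<in>F. \<forall>B\<in>F. A \<inter> B \<in> F) \<and>
     (\<forall>A\<in>F. \<forall>B. A \<subseteq> B \<and> B \<subseteq> S \<longrightarrow> B \<in> F)"

definition ultrafilter_on :: "'a set \<Rightarrow> 'a set set \<Rightarrow> bool" where
  "ultrafilter_on S u \<longleftrightarrow> filter_on S u \<and> (\<forall>F. filter_on S F \<and> u \<subseteq> F \<longrightarrow> F = u)"

definition principal_on :: "'a set \<Rightarrow> 'a set set \<Rightarrow> bool" where
  "principal_on S u \<longleftrightarrow> (\<exists>x\<in>S. u = {A. A \<subseteq> S \<and> x \<in> A})"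

definition filter_base :: "'a set set \<Rightarrow> 'a set set \<Rightarrow> bool" where
  "filter_base F B \<longleftrightarrow> B \<subseteq> F \<and> (\<forall>A\<in>F. \<exists>b\<in>B. b \<subseteq> A)"

text \<open>In \<^term>\<open>S \<inter> \<Inter>G\<close> the intersection with \<^term>\<open>S\<close> only matters for
  \<^term>\<open>G = {}\<close>, where \<^term>\<open>\<Inter>G\<close> is the whole type.\<close>

definition generated_filter :: "'a set \<Rightarrow> 'a set set \<Rightarrow> 'a set set" where
  "generated_filter S \<G> = {A. A \<subseteq> S \<and> (\<exists>G. finite G \<and> G \<subseteq> \<G> \<and> S \<inter> \<Inter>G \<subseteq> A)}"

text \<open>A property of subsets of a space is a predicate \<^term>\<open>R :: 'a set \<Rightarrow> bool\<close>.\<close>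

definition R_filter :: "('a set \<Rightarrow> bool) \<Rightarrow> 'a set \<Rightarrow> 'a set set \<Rightarrow> bool" where
  "R_filter R S F \<longleftrightarrow> filter_on S F \<and> (\<exists>B. filter_base F B \<and> (\<forall>b\<in>B. R b))"

definition R_ultrafilter :: "('a set \<Rightarrow> bool) \<Rightarrow> 'a set \<Rightarrow> 'a set set \<Rightarrow> bool" where
  "R_ultrafilter R S F \<longleftrightarrow>
     R_filter R S F \<and> (\<forall>A. A \<subseteq> S \<and> R A \<longrightarrow> A \<in> F \<or> S - A \<in> F)"

definition zero_cozero_closed_open_ultrafilter :: "'a topology \<Rightarrow> 'a set set \<Rightarrow> bool" where
  "zero_cozero_closed_open_ultrafilter X F \<longleftrightarrow>
     R_ultrafilter (zero_set X) (topspace X) F \<and>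
     R_ultrafilter (cozero_set X) (topspace X) F \<and>
     R_ultrafilter (closedin X) (topspace X) F \<and>
     R_ultrafilter (openin X) (topspace X) F"

definition accumulation_point :: "'a topology \<Rightarrow> 'a set set \<Rightarrow> 'a \<Rightarrow> bool" where
  "accumulation_point X F x \<longleftrightarrow> x \<in> topspace X \<and> (\<forall>A\<in>F. x \<in> X closure_of A)"

definition Op :: "'a topology \<Rightarrow> 'a set set \<Rightarrow> 'a set set" where
  "Op X u = generated_filter (topspace X) {A \<in> u. openin X A}"

definition Cl :: "'a topology \<Rightarrow> 'a set set \<Rightarrow> 'a set set" where
  "Cl X u = generated_filter (topspace X) {A \<in> u. closedin X A}"

definition Zf :: "'a topology \<Rightarrow> 'a set set \<Rightarrow> 'a set set" where
  "Zf X u = generated_filter (topspace X) {A \<in> u. zero_set X A}"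

definition Cz :: "'a topology \<Rightarrow> 'a set set \<Rightarrow> 'a set set" where
  "Cz X u = generated_filter (topspace X) {A \<in> u. cozero_set X A}"


section \<open>The Stone--Cech compactification\<close>

text \<open>It is constructed as the closure of the image of \<^term>\<open>X\<close> under the evaluation map into
  the cube whose coordinates are the continuous functions from \<^term>\<open>X\<close> to \<open>[0,1]\<close>.
  These are taken extensional, so that each function on the carrier is counted once.
  A subset of \<^term>\<open>X\<close> is identified with its image under the evaluation map.\<close>

definition unit_functions :: "'a topology \<Rightarrow> ('a \<Rightarrow> real) set" where
  "unit_functions X =
     {f \<in> extensional (topspace X). continuous_map X (top_of_set {0..1}) f}"

definition stone_cech_cube :: "'a topology \<Rightarrow> (('a \<Rightarrow> real) \<Rightarrow> real) topology" where
  "stone_cech_cube X = product_topology (\<lambda>f. top_of_set {0..1}) (unit_functions X)"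

definition stone_cech_map :: "'a topology \<Rightarrow> 'a \<Rightarrow> (('a \<Rightarrow> real) \<Rightarrow> real)" where
  "stone_cech_map X x = (\<lambda>f\<in>unit_functions X. f x)"

definition stone_cech :: "'a topology \<Rightarrow> (('a \<Rightarrow> real) \<Rightarrow> real) topology" where
  "stone_cech X = subtopology (stone_cech_cube X)
     (stone_cech_cube X closure_of (stone_cech_map X ` topspace X))"

definition stone_cech_remainder :: "'a topology \<Rightarrow> (('a \<Rightarrow> real) \<Rightarrow> real) set" where
  "stone_cech_remainder X = topspace (stone_cech X) - stone_cech_map X ` topspace X"

definition remote_point :: "'a topology \<Rightarrow> (('a \<Rightarrow> real) \<Rightarrow> real) \<Rightarrow> bool" where
  "remote_point X p \<longleftrightarrow>
     p \<in> stone_cech_remainder X \<and>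
     (\<forall>N. nowhere_dense_in X N \<longrightarrow> p \<notin> stone_cech X closure_of (stone_cech_map X ` N))"

text \<open>The characteristic properties: \<^term>\<open>stone_cech X\<close> is a compact Hausdorff space in which
  \<^term>\<open>X\<close> is densely embedded, and continuous functions from \<^term>\<open>X\<close> to \<open>[0,1]\<close> extend to it.\<close>

lemma embedding_map_stone_cech_cube:
  assumes "tychonoff_space X"
  shows "embedding_map X (stone_cech_cube X) (stone_cech_map X)"
proof -
  have eq: "unit_functions X =
      mspace (submetric (cfunspace X euclidean_metric) {f. f \<in> topspace X \<rightarrow> {0..1::real}})"
  proof -
    have "bounded (f ` topspace X)" if "f ` topspace X \<subseteq> {0..1::real}" for f
      using that bounded_closed_interval bounded_subset by blast
    then show ?thesis
      by (auto simp: unit_functions_def continuous_map_in_subtopology image_subset_iff Pi_iff)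
  qed
  show ?thesis
    using completely_regular_space_cube_embedding_explicit[of X] assms
    unfolding stone_cech_cube_def stone_cech_map_def[abs_def] eq tychonoff_space_def by blast
qed

lemma stone_cech_map_in_stone_cech:
  "stone_cech_map X ` topspace X \<subseteq> topspace (stone_cech X)"
proof -
  have "f x \<in> {0..1}" if "f \<in> unit_functions X" "x \<in> topspace X" for f x
    using that unfolding unit_functions_def continuous_map_in_subtopology
    by (blast dest: funcset_mem)
  then have "stone_cech_map X ` topspace X \<subseteq> topspace (stone_cech_cube X)"
    by (auto simp: stone_cech_cube_def stone_cech_map_def)
  then show ?thesis
    by (simp add: stone_cech_def closure_of_subset)
qed

lemma embedding_map_stone_cech:
  assumes "tychonoff_space X"
  shows "embedding_map X (stone_cech X) (stone_cech_map X)"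
proof -
  have "stone_cech_map X ` topspace X \<subseteq>
      stone_cech_cube X closure_of (stone_cech_map X ` topspace X)"
    using stone_cech_map_in_stone_cech[of X] by (simp add: stone_cech_def)
  then show ?thesis
    using embedding_map_stone_cech_cube[OF assms]
    unfolding embedding_map_def stone_cech_def subtopology_subtopology
    by (metis inf.absorb2)
qed

lemma compact_space_stone_cech: "compact_space (stone_cech X)"
proof -
  have "compact_space (stone_cech_cube X)"
    unfolding stone_cech_cube_def
    using compact_space_product_topology compact_space_subtopology compactin_euclidean_iff by blast
  then show ?thesis
    unfolding stone_cech_def
    by (simp add: closedin_compact_space compact_space_subtopology)
qed

lemma Hausdorff_space_stone_cech: "Hausdorff_space (stone_cech X)"
  unfolding stone_cech_def stone_cech_cube_def
  by (simp add: Hausdorff_space_subtopology Hausdorff_space_product_topology)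

lemma dense_in_stone_cech:
  "stone_cech X closure_of (stone_cech_map X ` topspace X) = topspace (stone_cech X)"
proof -
  have sub: "stone_cech_map X ` topspace X \<subseteq>
      stone_cech_cube X closure_of (stone_cech_map X ` topspace X)"
    using stone_cech_map_in_stone_cech[of X] by (simp add: stone_cech_def)
  show ?thesis
    unfolding stone_cech_def closure_of_subtopology topspace_subtopology inf.absorb2[OF sub]
    using closure_of_subset_topspace[of "stone_cech_cube X"] by blast
qed

lemma stone_cech_extension:
  assumes "continuous_map X (top_of_set {0..1::real}) f"
  obtains g where "continuous_map (stone_cech X) (top_of_set {0..1}) g"
    and "\<And>x. x \<in> topspace X \<Longrightarrow> g (stone_cech_map X x) = f x"
proof
  let ?f = "restrict f (topspace X)"
  have f: "?f \<in> unit_functions X"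
    using assms continuous_map_eq[of X _ f ?f] by (simp add: unit_functions_def)
  show "continuous_map (stone_cech X) (top_of_set {0..1}) (\<lambda>p. p ?f)"
    unfolding stone_cech_def stone_cech_cube_def
    using continuous_map_product_projection[OF f, of "\<lambda>_. top_of_set {0..1::real}"]
    by (rule continuous_map_from_subtopology)
  show "stone_cech_map X x ?f = f x" if "x \<in> topspace X" for x
    using f that by (simp add: stone_cech_map_def)
qed


section \<open>The ideal NF and weak compactness with respect to an ideal\<close>

definition NF :: "'a topology \<Rightarrow> 'a set set" where
  "NF X = {N \<union> F | N F. nowhere_dense_in X N \<and> finite F \<and> F \<subseteq> topspace X}"

definition weakly_compact_wrt :: "'a set set \<Rightarrow> 'a topology \<Rightarrow> bool" where
  "weakly_compact_wrt J X \<longleftrightarrow>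
     (\<forall>\<phi> :: 'a set \<Rightarrow> 'a set.
        (\<forall>A\<in>J. cozero_set X (\<phi> A) \<and> (\<exists>Z. zero_set X Z \<and> A \<subseteq> Z \<and> Z \<subseteq> \<phi> A)) \<longrightarrow>
        (\<exists>\<A>. finite \<A> \<and> \<A> \<subseteq> J \<and> (\<Union>A\<in>\<A>. \<phi> A) = topspace X))"

end

theory Submission
  imports Defs
begin

text \<open>For a remote point \<open>p\<close>, the traces on \<open>X\<close> of the neighbourhoods of \<open>p\<close> form the filter
  required in (b): bases of zero and cozero sets exist because \<open>\<beta>X\<close> is completely regular, and a
  closed set is decided because its frontier is nowhere dense, hence separated from \<open>p\<close>. Conversely,
  a cluster point in \<open>\<beta>X\<close> of a filter as in (b) is remote: the filter contains the complement of the
  closure of each nowhere dense set, and a zero set inside a cozero set inside this complement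
  gives disjoint closures in \<open>\<beta>X\<close>. Statements (b) and (c) are translated into each other by
  extending the filter to an ultrafilter. Finally, a remote point is separated from each \<open>A \<in> NF\<close> by
  a function, which provides \<open>\<phi>(A)\<close>, and by compactness of \<open>\<beta>X\<close> any \<open>\<phi>\<close> without a finite
  subcover has a point lying in the closures of all \<open>X - \<phi>(A)\<close>, which is remote.\<close>

section \<open>Zero sets and cozero sets\<close>

text \<open>Truncating \<open>\<bar>f x\<bar>\<close> at 1 keeps its zeros, so zero sets can be
  produced from arbitrary real functions without regard to their range.\<close>

lemma zero_set_iff:
  "zero_set X A \<longleftrightarrow>
     (\<exists>f. continuous_map X euclideanreal f \<and> A = {x \<in> topspace X. f x = 0})"
proof
  assume "zero_set X A"
  then show "\<exists>f. continuous_map X euclideanreal f \<and> A = {x \<in> topspace X. f x = 0}"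
    by (auto simp: zero_set_def continuous_map_in_subtopology)
next
  assume "\<exists>f. continuous_map X euclideanreal f \<and> A = {x \<in> topspace X. f x = 0}"
  then obtain f where f: "continuous_map X euclideanreal f" and A: "A = {x \<in> topspace X. f x = 0}"
    by blast
  have "continuous_map X euclideanreal (\<lambda>x. min 1 \<bar>f x\<bar>)"
    using f by (intro continuous_map_real_min continuous_map_real_abs) auto
  then have "continuous_map X (top_of_set {0..1}) (\<lambda>x. min 1 \<bar>f x\<bar>)"
    by (auto simp: continuous_map_in_subtopology)
  moreover have "A = {x \<in> topspace X. min 1 \<bar>f x\<bar> = 0}"
    unfolding A by (auto simp: min_def)
  ultimately show "zero_set X A"
    unfolding zero_set_def by (intro exI conjI)
qed

lemma zero_setI:
  "continuous_map X euclideanreal f \<Longrightarrow> zero_set X {x \<in> topspace X. f x = 0}"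
  by (auto simp: zero_set_iff)

lemma zero_set_subset: "zero_set X A \<Longrightarrow> A \<subseteq> topspace X"
  by (auto simp: zero_set_def)

lemma zero_set_imp_closedin: "zero_set X A \<Longrightarrow> closedin X A"
  using closedin_continuous_map_preimage[of X euclideanreal _ "{0}"] by (auto simp: zero_set_iff)

lemma zero_set_topspace: "zero_set X (topspace X)"
  using zero_setI[of X "\<lambda>x. 0"] by auto

lemma zero_set_empty: "zero_set X {}"
  using zero_setI[of X "\<lambda>x. 1"] by auto

lemma zero_set_Int:
  assumes "zero_set X A" "zero_set X B"
  shows "zero_set X (A \<inter> B)"
proof -
  obtain f g where f: "continuous_map X euclideanreal f" "A = {x \<in> topspace X. f x = 0}"
    and g: "continuous_map X euclideanreal g" "B = {x \<in> topspace X. g x = 0}"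
    using assms(1,2) unfolding zero_set_iff by blast
  have "zero_set X {x \<in> topspace X. \<bar>f x\<bar> + \<bar>g x\<bar> = 0}"
    using f g by (intro zero_setI continuous_map_add continuous_map_real_abs) auto
  also have "{x \<in> topspace X. \<bar>f x\<bar> + \<bar>g x\<bar> = 0} = A \<inter> B"
    using f g by auto
  finally show ?thesis .
qed

lemma zero_set_Un:
  assumes "zero_set X A" "zero_set X B"
  shows "zero_set X (A \<union> B)"
proof -
  obtain f g where f: "continuous_map X euclideanreal f" "A = {x \<in> topspace X. f x = 0}"
    and g: "continuous_map X euclideanreal g" "B = {x \<in> topspace X. g x = 0}"
    using assms(1,2) unfolding zero_set_iff by blast
  have "zero_set X {x \<in> topspace X. f x * g x = 0}"
    using f g by (intro zero_setI continuous_map_real_mult) auto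
  also have "{x \<in> topspace X. f x * g x = 0} = A \<union> B"
    using f g by auto
  finally show ?thesis .
qed

lemma zero_set_le:
  assumes "continuous_map X euclideanreal f"
  shows "zero_set X {x \<in> topspace X. f x \<le> c}"
proof -
  have "zero_set X {x \<in> topspace X. max (f x - c) 0 = 0}"
    using assms by (intro zero_setI continuous_map_real_max continuous_map_diff) auto
  also have "{x \<in> topspace X. max (f x - c) 0 = 0} = {x \<in> topspace X. f x \<le> c}"
    by (auto simp: max_def)
  finally show ?thesis .
qed

lemma zero_set_ge:
  assumes "continuous_map X euclideanreal f"
  shows "zero_set X {x \<in> topspace X. c \<le> f x}"
  using zero_set_le[of X "\<lambda>x. - f x" "- c"] assms by (simp add: continuous_map_minus)

lemma cozero_set_complement:
  "zero_set X A \<Longrightarrow> cozero_set X (topspace X - A)"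
  by (simp add: cozero_set_def double_diff zero_set_subset)

lemma cozero_set_less:
  assumes "continuous_map X euclideanreal f"
  shows "cozero_set X {x \<in> topspace X. f x < c}"
proof -
  have "{x \<in> topspace X. f x < c} = topspace X - {x \<in> topspace X. c \<le> f x}"
    by auto
  then show ?thesis
    by (simp add: cozero_set_complement zero_set_ge assms)
qed

lemma cozero_set_greater:
  assumes "continuous_map X euclideanreal f"
  shows "cozero_set X {x \<in> topspace X. c < f x}"
  using cozero_set_less[of X "\<lambda>x. - f x" "- c"] assms by (simp add: continuous_map_minus)

lemma cozero_set_imp_openin: "cozero_set X A \<Longrightarrow> openin X A"
  using openin_closedin zero_set_imp_closedin by (auto simp: cozero_set_def)

lemma cozero_set_topspace: "cozero_set X (topspace X)"
  by (simp add: cozero_set_def zero_set_empty)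

lemma cozero_set_Int: "cozero_set X A \<Longrightarrow> cozero_set X B \<Longrightarrow> cozero_set X (A \<inter> B)"
  by (auto simp: cozero_set_def Diff_Int zero_set_Un)

text \<open>With \<open>A\<close> and \<open>B\<close> the zero sets of \<open>f\<close> and
  \<open>g\<close>, the quotient \<open>\<bar>f\<bar> / (\<bar>f\<bar> + \<bar>g\<bar>)\<close>
  separates them; disjointness keeps the denominator positive.\<close>

lemma disjoint_zero_sets_separated:
  assumes "zero_set X A" "zero_set X B" "A \<inter> B = {}"
  obtains h where "continuous_map X (top_of_set {0..1::real}) h"
    "\<And>x. x \<in> A \<Longrightarrow> h x = 0" "\<And>x. x \<in> B \<Longrightarrow> h x = 1"
proof -
  obtain f g where f: "continuous_map X euclideanreal f" "A = {x \<in> topspace X. f x = 0}"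
    and g: "continuous_map X euclideanreal g" "B = {x \<in> topspace X. g x = 0}"
    using assms(1,2) unfolding zero_set_iff by blast
  define h where "h \<equiv> \<lambda>x. \<bar>f x\<bar> / (\<bar>f x\<bar> + \<bar>g x\<bar>)"
  have pos: "\<bar>f x\<bar> + \<bar>g x\<bar> > 0" if "x \<in> topspace X" for x
    using f g assms(3) that by (cases "f x = 0") (auto simp: add_pos_nonneg)
  have "continuous_map X euclideanreal h"
    unfolding h_def using f g pos
    by (intro continuous_map_real_divide continuous_map_add continuous_map_real_abs) fastforce+
  moreover have "h x \<in> {0..1}" if "x \<in> topspace X" for x
    using pos[OF that] by (auto simp: h_def field_simps)
  ultimately have "continuous_map X (top_of_set {0..1}) h"
    by (auto simp: continuous_map_in_subtopology)
  moreover have "h x = 0" if "x \<in> A" for x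
    using that f by (simp add: h_def)
  moreover have "h x = 1" if "x \<in> B" for x
    using that g pos by (force simp: h_def)
  ultimately show thesis
    using that by blast
qed

section \<open>Filters and ultrafilters\<close>

lemma filter_onD:
  assumes "filter_on S F"
  shows "S \<in> F" "{} \<notin> F" "A \<in> F \<Longrightarrow> A \<subseteq> S" "A \<in> F \<Longrightarrow> B \<in> F \<Longrightarrow> A \<inter> B \<in> F"
    "A \<in> F \<Longrightarrow> A \<subseteq> B \<Longrightarrow> B \<subseteq> S \<Longrightarrow> B \<in> F"
  using assms unfolding filter_on_def by blast+

lemma filter_on_Inter:
  assumes "filter_on S F" "finite G" "G \<subseteq> F"
  shows "S \<inter> \<Inter>G \<in> F"
  using assms(2,3)
proof (induction G)
  case empty
  then show ?case
    using filter_onD(1)[OF assms(1)] by simp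
next
  case (insert A G)
  then have "A \<inter> (S \<inter> \<Inter>G) \<in> F"
    using filter_onD(4)[OF assms(1)] by blast
  then show ?case
    by (simp add: Int_ac)
qed

lemma filter_on_Diff_notin:
  assumes "filter_on S F" "A \<in> F"
  shows "S - A \<notin> F"
  using filter_onD(2,4)[OF assms(1)] assms(2) by (metis Diff_disjoint)

text \<open>If \<open>S - A\<close> is not in \<open>u\<close>, every member of \<open>u\<close>
  meets \<open>A\<close>, so \<open>u\<close> and \<open>A\<close> together generate a proper
  filter; maximality then puts \<open>A\<close> into \<open>u\<close>.\<close>

lemma ultrafilter_on_or_Diff:
  assumes u: "ultrafilter_on S u" and "A \<subseteq> S"
  shows "A \<in> u \<or> S - A \<in> u"
proof (rule ccontr)
  assume *: "\<not> (A \<in> u \<or> S - A \<in> u)"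
  have F: "filter_on S u"
    using u by (simp add: ultrafilter_on_def)
  note F' = filter_onD[OF F]
  define v where "v = {B. B \<subseteq> S \<and> (\<exists>C\<in>u. C \<inter> A \<subseteq> B)}"
  have "C \<inter> A \<noteq> {}" if "C \<in> u" for C
  proof
    assume "C \<inter> A = {}"
    then have "C \<subseteq> S - A"
      using F'(3)[OF that] by blast
    then show False
      using F'(5)[OF that] * by blast
  qed
  moreover have "B \<inter> C \<in> v" if "B \<in> v" "C \<in> v" for B C
  proof -
    from that obtain D E where "D \<in> u" "D \<inter> A \<subseteq> B" "E \<in> u" "E \<inter> A \<subseteq> C"
      by (auto simp: v_def)
    then have "D \<inter> E \<in> u" "(D \<inter> E) \<inter> A \<subseteq> B \<inter> C"
      using F'(4) by auto
    then show ?thesis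
      using that by (auto simp: v_def)
  qed
  moreover have "S \<in> v"
    using F'(1) assms by (auto simp: v_def)
  moreover have "{} \<notin> v" if "\<And>C. C \<in> u \<Longrightarrow> C \<inter> A \<noteq> {}"
    using that unfolding v_def by blast
  moreover have "\<forall>B\<in>v. \<forall>C. B \<subseteq> C \<and> C \<subseteq> S \<longrightarrow> C \<in> v" "v \<subseteq> Pow S"
    unfolding v_def by blast+
  ultimately have "filter_on S v"
    unfolding filter_on_def by blast
  moreover have "u \<subseteq> v"
    using F'(3) by (auto simp: v_def)
  ultimately have "v = u"
    using u by (simp add: ultrafilter_on_def)
  moreover have "A \<in> v"
    using F'(1) assms by (auto simp: v_def)
  ultimately show False
    using * by blast
qed

text \<open>Zorn's lemma on the filters containing \<open>F\<close>: the union of a nonempty chain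
  of filters is again a filter.\<close>

lemma filter_on_extends_to_ultrafilter:
  assumes F: "filter_on S F"
  obtains u where "ultrafilter_on S u" "F \<subseteq> u"
proof -
  define \<A> where "\<A> = {G. filter_on S G \<and> F \<subseteq> G}"
  have "\<exists>M\<in>\<A>. \<forall>G\<in>\<A>. M \<subseteq> G \<longrightarrow> G = M"
  proof (rule subset_Zorn_nonempty)
    show "\<A> \<noteq> {}"
      using F by (auto simp: \<A>_def)
  next
    fix \<C>
    assume ne: "\<C> \<noteq> {}" and ch: "subset.chain \<A> \<C>"
    have filt: "filter_on S G" "F \<subseteq> G" if "G \<in> \<C>" for G
      using ch that by (auto simp: subset_chain_def \<A>_def)
    have lin: "G \<subseteq> H \<or> H \<subseteq> G" if "G \<in> \<C>" "H \<in> \<C>" for G H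
      using ch that by (auto simp: subset_chain_def)
    have "A \<inter> B \<in> \<Union>\<C>" if "A \<in> \<Union>\<C>" "B \<in> \<Union>\<C>" for A B
    proof -
      obtain G H where "G \<in> \<C>" "A \<in> G" "H \<in> \<C>" "B \<in> H"
        using \<open>A \<in> \<Union>\<C>\<close> \<open>B \<in> \<Union>\<C>\<close> by blast
      then show ?thesis
        using lin[of G H] filt(1) filter_onD(4) by (meson UnionI subsetD)
    qed
    moreover have "\<Union>\<C> \<noteq> {}"
      using ne filt filter_onD(1) by fastforce
    moreover have "\<Union>\<C> \<subseteq> Pow S" "{} \<notin> \<Union>\<C>"
      using filt(1) filter_onD(2,3) by blast+
    moreover have "\<forall>A\<in>\<Union>\<C>. \<forall>B. A \<subseteq> B \<and> B \<subseteq> S \<longrightarrow> B \<in> \<Union>\<C>"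
      using filt(1) filter_onD(5) by (metis Union_iff)
    ultimately have "filter_on S (\<Union>\<C>)"
      by (simp only: filter_on_def) blast
    then show "\<Union>\<C> \<in> \<A>"
      using ne filt(2) by (auto simp: \<A>_def)
  qed
  then obtain M where "M \<in> \<A>" "\<forall>G\<in>\<A>. M \<subseteq> G \<longrightarrow> G = M"
    by blast
  then have "ultrafilter_on S M" "F \<subseteq> M"
    unfolding ultrafilter_on_def \<A>_def by blast+
  then show thesis
    using that by blast
qed

lemma generated_filter_subset:
  assumes "filter_on S u" "\<G> \<subseteq> u"
  shows "generated_filter S \<G> \<subseteq> u"
  unfolding generated_filter_def
  using filter_on_Inter[OF assms(1)] filter_onD(5)[OF assms(1)] assms(2) by blast

text \<open>Closure of \<open>R\<close> under intersections replaces a finite family of generators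
  by a single one; \<open>R S\<close> takes care of the empty family.\<close>

lemma generated_filter_base:
  assumes u: "filter_on S u" and RS: "R S" and RI: "\<And>A B. R A \<Longrightarrow> R B \<Longrightarrow> R (A \<inter> B)"
  shows "generated_filter S {A \<in> u. R A} = {A. A \<subseteq> S \<and> (\<exists>B\<in>u. R B \<and> B \<subseteq> A)}"
proof -
  have "R (S \<inter> \<Inter>G)" if "finite G" "G \<subseteq> {A \<in> u. R A}" for G
    using that
  proof (induction G)
    case (insert A G)
    then have "R (A \<inter> (S \<inter> \<Inter>G))"
      using RI by blast
    then show ?case
      by (simp add: Int_ac)
  qed (simp add: RS)
  moreover have "S \<inter> \<Inter>G \<in> u" if "finite G" "G \<subseteq> {A \<in> u. R A}" for G
    using filter_on_Inter[OF u] that by blast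
  moreover have "\<exists>G. finite G \<and> G \<subseteq> {A \<in> u. R A} \<and> S \<inter> \<Inter>G \<subseteq> A"
    if "\<exists>B\<in>u. R B \<and> B \<subseteq> A" for A
  proof -
    from that obtain B where "B \<in> u" "R B" "B \<subseteq> A"
      by blast
    then show ?thesis
      by (intro exI[of _ "{B}"]) auto
  qed
  ultimately have "A \<in> generated_filter S {A \<in> u. R A} \<longleftrightarrow> A \<subseteq> S \<and> (\<exists>B\<in>u. R B \<and> B \<subseteq> A)" for A
    unfolding generated_filter_def mem_Collect_eq by metis
  then show ?thesis
    by blast
qed

lemma R_filter_generated_filter:
  assumes u: "filter_on S u" and RS: "R S" and RI: "\<And>A B. R A \<Longrightarrow> R B \<Longrightarrow> R (A \<inter> B)"
  shows "R_filter R S (generated_filter S {A \<in> u. R A})"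
proof -
  let ?F = "generated_filter S {A \<in> u. R A}"
  have F: "?F = {A. A \<subseteq> S \<and> (\<exists>B\<in>u. R B \<and> B \<subseteq> A)}"
    using assms by (intro generated_filter_base) auto
  have "S \<in> ?F"
    unfolding F using RS filter_onD(1)[OF u] by blast
  moreover have "{} \<notin> ?F"
    unfolding F using filter_onD(2)[OF u] by auto
  moreover have "A \<inter> B \<in> ?F" if A: "A \<in> ?F" and B: "B \<in> ?F" for A B
  proof -
    obtain C D where "C \<in> u" "R C" "C \<subseteq> A" "D \<in> u" "R D" "D \<subseteq> B"
      using A B unfolding F by blast
    then have "C \<inter> D \<in> u" "R (C \<inter> D)" "C \<inter> D \<subseteq> A \<inter> B"
      using RI filter_onD(4)[OF u] by auto
    then show ?thesis
      using A unfolding F by blast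
  qed
  moreover have "?F \<subseteq> Pow S" "\<forall>A\<in>?F. \<forall>B. A \<subseteq> B \<and> B \<subseteq> S \<longrightarrow> B \<in> ?F"
    unfolding F by blast+
  ultimately have "filter_on S ?F"
    unfolding filter_on_def by blast
  moreover have "filter_base ?F {A \<in> u. R A}"
    unfolding filter_base_def F using filter_onD(3)[OF u] by blast
  ultimately show ?thesis
    unfolding R_filter_def by blast
qed

lemma R_filter_base:
  assumes "R_filter R S F" "A \<in> F"
  obtains B where "B \<in> F" "R B" "B \<subseteq> A"
  using assms unfolding R_filter_def filter_base_def by blast

text \<open>If \<open>A\<close> is in \<open>u\<close> and has property \<open>R\<close>, then
  \<open>F\<close> must choose \<open>A\<close>, since \<open>S - A\<close> is not even in
  \<open>u\<close>. Hence the generated filter recovers \<open>F\<close> whichever ultrafilter above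
  \<open>F\<close> is taken.\<close>

lemma generated_filter_R_ultrafilter:
  assumes F: "R_ultrafilter R S F" and u: "ultrafilter_on S u" "F \<subseteq> u"
  shows "generated_filter S {A \<in> u. R A} = F"
proof
  have filt: "filter_on S F" "filter_on S u"
    using F u by (auto simp: R_ultrafilter_def R_filter_def ultrafilter_on_def)
  have "{A \<in> u. R A} \<subseteq> F"
  proof clarify
    fix A
    assume A: "A \<in> u" "R A"
    then have "S - A \<notin> F"
      using filter_on_Diff_notin[OF filt(2)] u(2) by blast
    then show "A \<in> F"
      using F A filter_onD(3)[OF filt(2)] unfolding R_ultrafilter_def by blast
  qed
  then show "generated_filter S {A \<in> u. R A} \<subseteq> F"
    by (rule generated_filter_subset[OF filt(1)])
  show "F \<subseteq> generated_filter S {A \<in> u. R A}"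
  proof
    fix A
    assume A: "A \<in> F"
    with F obtain B where "B \<in> F" "R B" "B \<subseteq> A"
      unfolding R_ultrafilter_def using R_filter_base by blast
    then show "A \<in> generated_filter S {A \<in> u. R A}"
      unfolding generated_filter_def using u(2) filter_onD(3)[OF filt(1) A]
      by (intro CollectI conjI exI[of _ "{B}"]) auto
  qed
qed

section \<open>Equivalence of (b) and (c)\<close>

text \<open>All four generated filters equal \<open>F\<close> for any ultrafilter \<open>u\<close>
  above \<open>F\<close>. Were \<open>u\<close> principal at \<open>x\<close>, all members of
  \<open>F\<close> would contain \<open>x\<close>, making \<open>x\<close> an accumulation
  point.\<close>

lemma ultrafilter_of_zero_cozero_closed_open:
  assumes F: "zero_cozero_closed_open_ultrafilter X F" and acc: "\<nexists>x. accumulation_point X F x"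
  shows "\<exists>u. ultrafilter_on (topspace X) u \<and> \<not> principal_on (topspace X) u \<and>
               Op X u = Cl X u \<and> Cl X u = Zf X u \<and> Zf X u = Cz X u"
proof -
  have filt: "filter_on (topspace X) F"
    using F by (simp add: zero_cozero_closed_open_ultrafilter_def R_ultrafilter_def R_filter_def)
  then obtain u where u: "ultrafilter_on (topspace X) u" "F \<subseteq> u"
    using filter_on_extends_to_ultrafilter by blast
  then have "Op X u = F" "Cl X u = F" "Zf X u = F" "Cz X u = F"
    using F unfolding zero_cozero_closed_open_ultrafilter_def Op_def Cl_def Zf_def Cz_def
    by (simp_all add: generated_filter_R_ultrafilter)
  moreover have "\<not> principal_on (topspace X) u"
  proof
    assume "principal_on (topspace X) u"
    then obtain x where x: "x \<in> topspace X" "u = {A. A \<subseteq> topspace X \<and> x \<in> A}"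
      by (auto simp: principal_on_def)
    have "x \<in> X closure_of A" if "A \<in> F" for A
      using closure_of_subset[of A X] u(2) x(2) that by auto
    then have "accumulation_point X F x"
      using x(1) by (simp add: accumulation_point_def)
    then show False
      using acc by blast
  qed
  ultimately show ?thesis
    using u(1) by auto
qed

text \<open>The common value of the four filters inherits a base of each kind and decides open and
  closed sets because \<open>u\<close> does. Since points are closed, an accumulation point
  \<open>x\<close> would force \<open>{x}\<close> into \<open>u\<close>.\<close>

lemma zero_cozero_closed_open_of_ultrafilter:
  assumes X: "t1_space X" and u: "ultrafilter_on (topspace X) u" and np: "\<not> principal_on (topspace X) u"
    and eq: "Op X u = Cl X u" "Cl X u = Zf X u" "Zf X u = Cz X u"
  shows "\<exists>F. zero_cozero_closed_open_ultrafilter X F \<and> (\<nexists>x. accumulation_point X F x)"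
proof (intro exI conjI)
  let ?F = "Cl X u"
  let ?S = "topspace X"
  have filt: "filter_on ?S u"
    using u by (simp add: ultrafilter_on_def)
  have gen: "A \<in> generated_filter ?S {A \<in> u. R A}" if "A \<in> u" "R A" for A and R :: "'a set \<Rightarrow> bool"
    unfolding generated_filter_def using that filter_onD(3)[OF filt that(1)]
    by (intro CollectI conjI exI[of _ "{A}"]) auto
  \<comment> \<open>An open member of \<open>u\<close> is a generator of \<open>Op X u\<close>, a
    closed one of \<open>Cl X u\<close>, and the two filters coincide.\<close>
  have F: "A \<in> ?F" if "A \<in> u" "openin X A \<or> closedin X A" for A
    using that gen[of A] eq unfolding Op_def Cl_def by metis
  have dich: "A \<in> ?F \<or> ?S - A \<in> ?F" if "openin X A \<or> closedin X A" for A
  proof -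
    have "A \<subseteq> ?S"
      using that openin_subset closedin_subset by blast
    then have "A \<in> u \<or> ?S - A \<in> u"
      by (rule ultrafilter_on_or_Diff[OF u])
    then show ?thesis
      using that F by blast
  qed
  have "R_filter (openin X) ?S (Op X u)" "R_filter (closedin X) ?S (Cl X u)"
    "R_filter (zero_set X) ?S (Zf X u)" "R_filter (cozero_set X) ?S (Cz X u)"
    unfolding Op_def Cl_def Zf_def Cz_def
    by (intro R_filter_generated_filter[OF filt]; blast intro: zero_set_Int zero_set_topspace
        cozero_set_Int cozero_set_topspace)+
  then have R: "R_filter (openin X) ?S ?F" "R_filter (closedin X) ?S ?F"
    "R_filter (zero_set X) ?S ?F" "R_filter (cozero_set X) ?S ?F"
    using eq by simp_all
  show "zero_cozero_closed_open_ultrafilter X ?F"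
    unfolding zero_cozero_closed_open_ultrafilter_def R_ultrafilter_def
    by (intro conjI allI impI R; use dich zero_set_imp_closedin cozero_set_imp_openin in blast)
  show "\<nexists>x. accumulation_point X ?F x"
  proof
    assume "\<exists>x. accumulation_point X ?F x"
    then obtain x where x: "x \<in> ?S" and acc: "\<And>A. A \<in> ?F \<Longrightarrow> x \<in> X closure_of A"
      by (auto simp: accumulation_point_def)
    have cl: "closedin X {x}"
      using X x by (simp add: closedin_t1_singleton)
    \<comment> \<open>Otherwise this open set would lie in \<open>?F\<close> and contain a closed
      member of \<open>?F\<close>, which would miss the accumulation point \<open>x\<close>.\<close>
    have "?S - {x} \<notin> u"
    proof
      assume "?S - {x} \<in> u"
      then have "?S - {x} \<in> ?F"
        using cl by (intro F) auto
      then obtain B where "B \<in> ?F" "closedin X B" "B \<subseteq> ?S - {x}"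
        using R_filter_base[OF R(2)] by blast
      then show False
        using acc[of B] by (simp add: closure_of_closedin) blast
    qed
    then have "{x} \<in> u"
      using ultrafilter_on_or_Diff[OF u, of "{x}"] x by blast
    moreover have "x \<in> A" if "A \<in> u" for A
      using filter_onD(2,4)[OF filt] that \<open>{x} \<in> u\<close> by (metis Int_insert_right_if0 Int_empty_right)
    ultimately have "u = {A. A \<subseteq> ?S \<and> x \<in> A}"
      using filter_onD(3,5)[OF filt] by blast
    then show False
      using np x by (auto simp: principal_on_def)
  qed
qed

section \<open>Remote points\<close>

lemma continuous_map_stone_cech_map:
  assumes "tychonoff_space X"
  shows "continuous_map X (stone_cech X) (stone_cech_map X)"
  using homeomorphic_imp_continuous_map[OF embedding_map_stone_cech[OF assms, unfolded embedding_map_def]]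
  by (simp add: continuous_map_in_subtopology)

lemma nowhere_dense_in_NF: "nowhere_dense_in X N \<Longrightarrow> N \<in> NF X"
  unfolding NF_def by (intro CollectI exI[of _ N] exI[of _ "{}"]) simp

lemma finite_in_NF:
  assumes "finite E" "E \<subseteq> topspace X"
  shows "E \<in> NF X"
proof -
  have "nowhere_dense_in X {}"
    by (simp add: nowhere_dense_in_def)
  then show ?thesis
    unfolding NF_def using assms by (intro CollectI exI[of _ "{}"] exI[of _ E]) simp
qed

text \<open>A function separating the two zero sets extends to the compactification, where by
  continuity it is 0 on one closure and 1 on the other.\<close>

lemma stone_cech_closures_disjoint:
  assumes "zero_set X A" "zero_set X B" "A \<inter> B = {}"
  shows "stone_cech X closure_of (stone_cech_map X ` A) \<inter>
         stone_cech X closure_of (stone_cech_map X ` B) = {}"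
proof -
  let ?b = "stone_cech X"
  let ?e = "stone_cech_map X"
  obtain h where h: "continuous_map X (top_of_set {0..1::real}) h"
    "\<And>x. x \<in> A \<Longrightarrow> h x = 0" "\<And>x. x \<in> B \<Longrightarrow> h x = 1"
    using disjoint_zero_sets_separated[OF assms] by metis
  obtain g where "continuous_map ?b (top_of_set {0..1}) g"
    and ge: "\<And>x. x \<in> topspace X \<Longrightarrow> g (?e x) = h x"
    using stone_cech_extension[OF h(1)] by metis
  then have g: "continuous_map ?b euclideanreal g"
    by (simp add: continuous_map_in_subtopology)
  have sub: "A \<subseteq> topspace X" "B \<subseteq> topspace X"
    using assms zero_set_subset by blast+
  have g0: "g q = 0" if "q \<in> ?e ` A" for q
    using that sub ge h(2) by auto
  have g1: "g q = 1" if "q \<in> ?e ` B" for q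
    using that sub ge h(3) by auto
  have "g p = 0" if "p \<in> ?b closure_of (?e ` A)" for p
    using forall_in_closure_of_eq[OF that, of euclideanreal g "\<lambda>_. 0"] g g0 by simp
  moreover have "g p = 1" if "p \<in> ?b closure_of (?e ` B)" for p
    using forall_in_closure_of_eq[OF that, of euclideanreal g "\<lambda>_. 1"] g g1 by simp
  ultimately show ?thesis
    by fastforce
qed

lemma stone_cech_Urysohn:
  assumes "p \<in> topspace (stone_cech X)" "closedin (stone_cech X) C" "p \<notin> C"
  obtains f where "continuous_map (stone_cech X) euclideanreal f" "f p = 0"
    "\<And>q. q \<in> C \<Longrightarrow> f q = 1"
proof -
  have "completely_regular_space (stone_cech X)"
    using compact_space_stone_cech Hausdorff_space_stone_cech
    by (intro normal_imp_completely_regular_space compact_Hausdorff_or_regular_imp_normal_space) auto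
  then obtain f where "continuous_map (stone_cech X) (top_of_set {0..1::real}) f" "f p = 0" "f ` C \<subseteq> {1}"
    using assms unfolding completely_regular_space_def by blast
  then show thesis
    by (intro that[of f]) (auto simp: continuous_map_in_subtopology)
qed

text \<open>This form of density makes the trace filter proper and finds points of \<open>X\<close>
  that finitely many sets \<open>\<phi> A\<close> leave uncovered.\<close>

lemma stone_cech_nbhd_meets:
  assumes "openin (stone_cech X) U" "p \<in> U"
  obtains x where "x \<in> topspace X" "stone_cech_map X x \<in> U"
proof -
  have "p \<in> stone_cech X closure_of (stone_cech_map X ` topspace X)"
    using assms openin_subset dense_in_stone_cech by fastforce
  then show thesis
    using assms that unfolding in_closure_of by blast
qed

text \<open>The map is a homeomorphism onto its image, and closure in the image is the trace of
  closure in the compactification. Thus a cluster point lying in the image of \<open>X\<close>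
  yields an accumulation point in \<open>X\<close>.\<close>

lemma stone_cech_map_in_closure_iff:
  assumes X: "tychonoff_space X" and x: "x \<in> topspace X" and A: "A \<subseteq> topspace X"
  shows "stone_cech_map X x \<in> stone_cech X closure_of (stone_cech_map X ` A) \<longleftrightarrow>
         x \<in> X closure_of A"
proof
  assume "x \<in> X closure_of A"
  then show "stone_cech_map X x \<in> stone_cech X closure_of (stone_cech_map X ` A)"
    using continuous_map_image_closure_subset[OF continuous_map_stone_cech_map[OF X]] by blast
next
  let ?e = "stone_cech_map X"
  let ?b = "stone_cech X"
  assume R: "?e x \<in> ?b closure_of (?e ` A)"
  have hom: "homeomorphic_map X (subtopology ?b (?e ` topspace X)) ?e"
    using embedding_map_stone_cech[OF X] by (simp add: embedding_map_def)
  have "?e x \<in> subtopology ?b (?e ` topspace X) closure_of (?e ` A)"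
    using R x A by (simp add: closure_of_subtopology Int_absorb1 image_mono)
  then have "?e x \<in> ?e ` (X closure_of A)"
    using homeomorphic_map_closure_of[OF hom A] by simp
  moreover have "inj_on ?e (topspace X)"
    using homeomorphic_imp_injective_map[OF hom] .
  ultimately show "x \<in> X closure_of A"
    using x closure_of_subset_topspace[of X A] by (auto dest: inj_onD)
qed

section \<open>Remote points and weak compactness with respect to \<open>NF\<close>\<close>

text \<open>Remoteness keeps \<open>p\<close> out of the closure of the nowhere dense part, and
  lying in the remainder keeps it out of the finite part, which is already closed. Urysohn
  separation applies to the union.\<close>

lemma remote_point_separation_NF:
  assumes X: "tychonoff_space X" and p: "remote_point X p" and A: "A \<in> NF X"
  obtains f where "continuous_map (stone_cech X) euclideanreal f" "f p = 0"
    "\<And>x. x \<in> A \<Longrightarrow> f (stone_cech_map X x) = 1"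
proof -
  let ?b = "stone_cech X"
  let ?e = "stone_cech_map X"
  obtain N E where N: "nowhere_dense_in X N" and E: "finite E" "E \<subseteq> topspace X" and AE: "A = N \<union> E"
    using A by (auto simp: NF_def)
  let ?C = "?b closure_of (?e ` N) \<union> ?e ` E"
  have "closedin ?b (?e ` E)"
    using E stone_cech_map_in_stone_cech[of X]
    by (intro closedin_Hausdorff_finite[OF Hausdorff_space_stone_cech]) auto
  then have "closedin ?b ?C"
    by (simp add: closedin_Un)
  moreover have "p \<in> topspace ?b" "p \<notin> ?C"
    using p N E by (auto simp: remote_point_def stone_cech_remainder_def)
  ultimately obtain f where f: "continuous_map ?b euclideanreal f" "f p = 0" "\<And>q. q \<in> ?C \<Longrightarrow> f q = 1"
    using stone_cech_Urysohn by metis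
  have "?e ` N \<subseteq> ?b closure_of (?e ` N)"
    using N stone_cech_map_in_stone_cech[of X]
    by (intro closure_of_subset) (auto simp: nowhere_dense_in_def)
  then have "f (?e x) = 1" if "x \<in> A" for x
    using that AE by (intro f(3)) auto
  then show thesis
    using f that by blast
qed

text \<open>Each \<open>\<phi> A\<close> stays away from \<open>p\<close>: finitely many of the
  separating functions are simultaneously small on a neighbourhood of \<open>p\<close>, and this
  neighbourhood contains a point of \<open>X\<close>.\<close>

lemma remote_point_imp_not_weakly_compact:
  assumes X: "tychonoff_space X" and p: "remote_point X p"
  shows "\<not> weakly_compact_wrt (NF X) X"
proof
  let ?b = "stone_cech X"
  let ?e = "stone_cech_map X"
  assume wc: "weakly_compact_wrt (NF X) X"
  have "\<exists>f. continuous_map ?b euclideanreal f \<and> f p = 0 \<and> (\<forall>x\<in>A. f (?e x) = 1)" if "A \<in> NF X" for A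
    using remote_point_separation_NF[OF X p that] by metis
  then obtain f where f: "\<And>A. A \<in> NF X \<Longrightarrow> continuous_map ?b euclideanreal (f A)"
    "\<And>A. A \<in> NF X \<Longrightarrow> f A p = 0" "\<And>A x. A \<in> NF X \<Longrightarrow> x \<in> A \<Longrightarrow> f A (?e x) = 1"
    by metis
  \<comment> \<open>The separating function is 1 on \<open>A\<close>, so the zero set where it is at
    least 2/3 fits between \<open>A\<close> and this cozero set.\<close>
  define \<phi> where "\<phi> A = {x \<in> topspace X. 1/3 < f A (?e x)}" for A
  have "cozero_set X (\<phi> A) \<and> (\<exists>Z. zero_set X Z \<and> A \<subseteq> Z \<and> Z \<subseteq> \<phi> A)" if A: "A \<in> NF X" for A
  proof -
    have cont: "continuous_map X euclideanreal (\<lambda>x. f A (?e x))"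
      using continuous_map_compose[OF continuous_map_stone_cech_map[OF X] f(1)[OF A]] by (simp add: o_def)
    have "A \<subseteq> topspace X"
      using A by (auto simp: NF_def nowhere_dense_in_def)
    then have "A \<subseteq> {x \<in> topspace X. 2/3 \<le> f A (?e x)}"
      using f(3)[OF A] by auto
    moreover have "{x \<in> topspace X. 2/3 \<le> f A (?e x)} \<subseteq> \<phi> A"
      by (auto simp: \<phi>_def)
    ultimately show ?thesis
      using zero_set_ge[OF cont] cozero_set_greater[OF cont] unfolding \<phi>_def by blast
  qed
  then have "\<exists>\<A>. finite \<A> \<and> \<A> \<subseteq> NF X \<and> (\<Union>A\<in>\<A>. \<phi> A) = topspace X"
    by (intro wc[unfolded weakly_compact_wrt_def, rule_format]) simp
  then obtain \<A> where \<A>: "finite \<A>" "\<A> \<subseteq> NF X" and cov: "(\<Union>A\<in>\<A>. \<phi> A) = topspace X"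
    by blast
  \<comment> \<open>The factor \<open>topspace ?b\<close> keeps \<open>?U\<close> open inside the
    space when \<open>\<A>\<close> is empty.\<close>
  let ?U = "(\<Inter>A\<in>\<A>. {q \<in> topspace ?b. f A q \<in> {..<1/3}}) \<inter> topspace ?b"
  have "openin ?b {q \<in> topspace ?b. f A q \<in> {..<1/3}}" if "A \<in> \<A>" for A
    using openin_continuous_map_preimage[OF f(1), of A "{..<1/3}"] \<A>(2) that by auto
  then have "openin ?b ?U"
    using \<A>(1) by (intro openin_INT) auto
  moreover have "p \<in> topspace ?b"
    using p by (simp add: remote_point_def stone_cech_remainder_def)
  then have "p \<in> ?U"
    using \<A>(2) f(2) by (auto simp: subset_iff)
  ultimately obtain x where x: "x \<in> topspace X" "?e x \<in> ?U"
    using stone_cech_nbhd_meets by blast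
  then obtain A where "A \<in> \<A>" "x \<in> \<phi> A"
    using cov by blast
  then show False
    using x(2) by (auto simp: \<phi>_def)
qed

text \<open>Compactness applied to the closures of the images: a point common to finitely many
  members of \<open>\<C>\<close> is mapped into all their closures.\<close>

lemma stone_cech_fip:
  assumes "\<And>C. C \<in> \<C> \<Longrightarrow> C \<subseteq> topspace X"
    and "\<And>\<F>. finite \<F> \<Longrightarrow> \<F> \<subseteq> \<C> \<Longrightarrow> topspace X \<inter> \<Inter>\<F> \<noteq> {}"
  obtains p where "p \<in> topspace (stone_cech X)"
    "\<And>C. C \<in> \<C> \<Longrightarrow> p \<in> stone_cech X closure_of (stone_cech_map X ` C)"
proof -
  let ?b = "stone_cech X"
  let ?e = "stone_cech_map X"
  let ?k = "\<lambda>C. ?b closure_of (?e ` C)"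
  \<comment> \<open>Inserting the whole space forces the common point into it even if
    \<open>\<C>\<close> is empty.\<close>
  have "\<Inter> (insert (topspace ?b) (?k ` \<C>)) \<noteq> {}"
  proof (rule compact_space_fip[THEN iffD1, OF compact_space_stone_cech, rule_format], intro conjI allI impI ballI)
    fix D
    assume "D \<in> insert (topspace ?b) (?k ` \<C>)"
    then show "closedin ?b D"
      by auto
  next
    fix \<F>
    assume "finite \<F> \<and> \<F> \<subseteq> insert (topspace ?b) (?k ` \<C>)"
    then have \<F>: "finite (\<F> - {topspace ?b})" "\<F> - {topspace ?b} \<subseteq> ?k ` \<C>"
      by auto
    obtain \<D> where \<D>: "\<D> \<subseteq> \<C>" "finite \<D>" "\<F> - {topspace ?b} = ?k ` \<D>"
      using finite_subset_image[OF \<F>] by blast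
    obtain x where x: "x \<in> topspace X" "x \<in> \<Inter>\<D>"
      using assms(2)[OF \<D>(2,1)] by blast
    have "?e x \<in> ?k D" if "D \<in> \<D>" for D
    proof -
      have "?e ` D \<subseteq> topspace ?b"
        using assms(1)[of D] \<D>(1) that stone_cech_map_in_stone_cech[of X] by blast
      then show ?thesis
        using closure_of_subset x that by fastforce
    qed
    moreover have "?e x \<in> topspace ?b"
      using x stone_cech_map_in_stone_cech[of X] by blast
    ultimately have "?e x \<in> D" if "D \<in> \<F>" for D
      using \<D>(3) that by (cases "D = topspace ?b") blast+
    then show "\<Inter>\<F> \<noteq> {}"
      by blast
  qed
  then show thesis
    using that by auto
qed

text \<open>The complements of the sets \<open>\<phi> A\<close> have the finite intersection
  property, which provides \<open>p\<close>. The zero set between \<open>A\<close> and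
  \<open>\<phi> A\<close> is disjoint from the zero set \<open>topspace X - \<phi> A\<close>, so
  \<open>p\<close> avoids the closure of \<open>A\<close>.\<close>

lemma not_weakly_compact_imp_remote_point:
  assumes X: "tychonoff_space X" and nwc: "\<not> weakly_compact_wrt (NF X) X"
  shows "\<exists>p. remote_point X p"
proof -
  let ?b = "stone_cech X"
  let ?e = "stone_cech_map X"
  obtain \<phi> where "\<forall>A\<in>NF X. cozero_set X (\<phi> A) \<and> (\<exists>Z. zero_set X Z \<and> A \<subseteq> Z \<and> Z \<subseteq> \<phi> A)"
    and "\<nexists>\<A>. finite \<A> \<and> \<A> \<subseteq> NF X \<and> (\<Union>A\<in>\<A>. \<phi> A) = topspace X"
    using nwc unfolding weakly_compact_wrt_def not_all not_imp by (elim exE conjE)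
  then have \<phi>: "\<And>A. A \<in> NF X \<Longrightarrow> cozero_set X (\<phi> A)"
    "\<And>A. A \<in> NF X \<Longrightarrow> \<exists>Z. zero_set X Z \<and> A \<subseteq> Z \<and> Z \<subseteq> \<phi> A"
    and ncov: "\<And>\<A>. finite \<A> \<Longrightarrow> \<A> \<subseteq> NF X \<Longrightarrow> (\<Union>A\<in>\<A>. \<phi> A) \<noteq> topspace X"
    by simp_all
  let ?\<C> = "(\<lambda>A. topspace X - \<phi> A) ` NF X"
  have "topspace X \<inter> \<Inter>\<F> \<noteq> {}" if \<F>: "finite \<F>" "\<F> \<subseteq> ?\<C>" for \<F>
  proof -
    obtain \<A> where \<A>: "\<A> \<subseteq> NF X" "finite \<A>" "\<F> = (\<lambda>A. topspace X - \<phi> A) ` \<A>"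
      using finite_subset_image[OF \<F>] by blast
    have "(\<Union>A\<in>\<A>. \<phi> A) \<subseteq> topspace X"
      using \<phi>(1) \<A>(1) by (auto simp: cozero_set_def)
    then obtain x where "x \<in> topspace X" "x \<notin> (\<Union>A\<in>\<A>. \<phi> A)"
      using ncov[OF \<A>(2,1)] by blast
    then show ?thesis
      using \<A>(3) by auto
  qed
  then obtain p where p: "p \<in> topspace ?b"
    and "\<And>C. C \<in> ?\<C> \<Longrightarrow> p \<in> ?b closure_of (?e ` C)"
    using stone_cech_fip[of ?\<C> X] by auto
  then have pcl: "p \<in> ?b closure_of (?e ` (topspace X - \<phi> A))" if "A \<in> NF X" for A
    using that by blast
  have notin: "p \<notin> ?b closure_of (?e ` A)" if A: "A \<in> NF X" for A
  proof
    assume "p \<in> ?b closure_of (?e ` A)"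
    moreover obtain Z where Z: "zero_set X Z" "A \<subseteq> Z" "Z \<subseteq> \<phi> A"
      using \<phi>(2)[OF A] by blast
    ultimately have "p \<in> ?b closure_of (?e ` Z)"
      using closure_of_mono[of "?e ` A" "?e ` Z"] by blast
    moreover have "zero_set X (topspace X - \<phi> A)" "Z \<inter> (topspace X - \<phi> A) = {}"
      using \<phi>(1)[OF A] Z by (auto simp: cozero_set_def)
    ultimately show False
      using pcl[OF A] stone_cech_closures_disjoint[OF Z(1)] by blast
  qed
  \<comment> \<open>Here the finite sets in \<open>NF\<close> matter: they cover singletons of
    isolated points, which are not nowhere dense.\<close>
  have "p \<notin> ?e ` topspace X"
  proof
    assume "p \<in> ?e ` topspace X"
    then obtain x where x: "x \<in> topspace X" "p = ?e x"
      by blast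
    moreover have "{x} \<in> NF X"
      using x by (simp add: finite_in_NF)
    ultimately show False
      using notin[of "{x}"] p closure_of_subset[of "?e ` {x}" ?b] by auto
  qed
  moreover have "N \<in> NF X" if "nowhere_dense_in X N" for N
    using that by (rule nowhere_dense_in_NF)
  ultimately have "remote_point X p"
    using p notin by (auto simp: remote_point_def stone_cech_remainder_def)
  then show ?thesis
    by blast
qed

section \<open>From (b) to a remote point\<close>

lemma zero_cozero_closed_open_imp_remote_point:
  assumes X: "tychonoff_space X" and F: "zero_cozero_closed_open_ultrafilter X F"
    and acc: "\<nexists>x. accumulation_point X F x"
  shows "\<exists>p. remote_point X p"
proof -
  let ?b = "stone_cech X"
  let ?e = "stone_cech_map X"
  let ?S = "topspace X"
  have R: "R_filter (zero_set X) ?S F" "R_filter (cozero_set X) ?S F" "R_filter (openin X) ?S F"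
    and cl': "R_ultrafilter (closedin X) ?S F"
    using F unfolding zero_cozero_closed_open_ultrafilter_def R_ultrafilter_def by simp_all
  have cl: "A \<in> F \<or> ?S - A \<in> F" if "closedin X A" for A
    using cl' that closedin_subset[OF that] by (simp add: R_ultrafilter_def)
  have filt: "filter_on ?S F"
    using R(1) by (simp add: R_filter_def)
  have "topspace X \<inter> \<Inter>\<F> \<noteq> {}" if "finite \<F>" "\<F> \<subseteq> F" for \<F>
    using filter_on_Inter[OF filt that] filter_onD(2)[OF filt] by metis
  then obtain p where p: "p \<in> topspace ?b" and pcl: "\<And>A. A \<in> F \<Longrightarrow> p \<in> ?b closure_of (?e ` A)"
    using stone_cech_fip[of F X] filter_onD(3)[OF filt] by metis
  have "p \<notin> ?e ` ?S"
  proof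
    assume "p \<in> ?e ` ?S"
    then obtain x where x: "x \<in> ?S" "p = ?e x"
      by blast
    then have "x \<in> X closure_of A" if "A \<in> F" for A
      using stone_cech_map_in_closure_iff[OF X x(1)] pcl[OF that] filter_onD(3)[OF filt that] by blast
    then show False
      using acc x by (auto simp: accumulation_point_def)
  qed
  moreover have "p \<notin> ?b closure_of (?e ` N)" if N: "nowhere_dense_in X N" for N
  proof -
    \<comment> \<open>A member of the open base inside this closure would be a nonempty open set in
      its interior.\<close>
    have "X closure_of N \<notin> F"
    proof
      assume "X closure_of N \<in> F"
      then obtain U where U: "U \<in> F" "openin X U" "U \<subseteq> X closure_of N"
        using R_filter_base[OF R(3)] by blast
      then have "U \<subseteq> X interior_of (X closure_of N)"
        by (simp add: interior_of_maximal)
      then show False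
        using N U(1) filter_onD(2)[OF filt] by (auto simp: nowhere_dense_in_def)
    qed
    then have "?S - X closure_of N \<in> F"
      using cl[OF closedin_closure_of, of N] by blast
    \<comment> \<open>Shrinking twice gives two disjoint zero sets: \<open>?S - C\<close>, which
      contains \<open>N\<close>, and \<open>Z\<close>, which belongs to \<open>F\<close> and so has
      \<open>p\<close> in its closure.\<close>
    then obtain C where C: "C \<in> F" "cozero_set X C" "C \<subseteq> ?S - X closure_of N"
      using R_filter_base[OF R(2)] by blast
    obtain Z where Z: "Z \<in> F" "zero_set X Z" "Z \<subseteq> C"
      using R_filter_base[OF R(1) C(1)] by blast
    have "N \<subseteq> ?S - C"
      using C(3) N closure_of_subset[of N X] by (auto simp: nowhere_dense_in_def)
    then have "?b closure_of (?e ` N) \<subseteq> ?b closure_of (?e ` (?S - C))"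
      by (intro closure_of_mono image_mono)
    moreover have "zero_set X (?S - C)" "Z \<inter> (?S - C) = {}"
      using C(2) Z(3) by (auto simp: cozero_set_def)
    ultimately show ?thesis
      using stone_cech_closures_disjoint[OF Z(2)] pcl[OF Z(1)] by blast
  qed
  ultimately have "remote_point X p"
    using p by (auto simp: remote_point_def stone_cech_remainder_def)
  then show ?thesis
    by blast
qed

section \<open>From a remote point to (b)\<close>

text \<open>The frontier of a closed set lies in the set, so its interior lies in the interior of
  \<open>A\<close>, which the frontier misses.\<close>

lemma nowhere_dense_in_frontier_of:
  assumes "closedin X A"
  shows "nowhere_dense_in X (X frontier_of A)"
proof -
  have "X interior_of (X frontier_of A) \<subseteq> X interior_of A"
    using assms by (intro interior_of_mono) (simp add: frontier_of_subset_closedin)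
  moreover have "X interior_of (X frontier_of A) \<subseteq> X frontier_of A"
    by (rule interior_of_subset)
  ultimately have "X interior_of (X frontier_of A) = {}"
    by (auto simp: frontier_of_def)
  then show ?thesis
    by (simp add: nowhere_dense_in_def closure_of_closedin closedin_frontier_of frontier_of_subset_topspace)
qed

definition trace_filter :: "'a topology \<Rightarrow> (('a \<Rightarrow> real) \<Rightarrow> real) \<Rightarrow> 'a set set" where
  "trace_filter X p = {A. A \<subseteq> topspace X \<and>
     (\<exists>U. openin (stone_cech X) U \<and> p \<in> U \<and> {x \<in> topspace X. stone_cech_map X x \<in> U} \<subseteq> A)}"

lemma trace_filterI:
  assumes "openin (stone_cech X) U" "p \<in> U" "A \<subseteq> topspace X"
    "\<And>x. x \<in> topspace X \<Longrightarrow> stone_cech_map X x \<in> U \<Longrightarrow> x \<in> A"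
  shows "A \<in> trace_filter X p"
  using assms by (auto simp: trace_filter_def)

lemma filter_on_trace_filter:
  assumes "p \<in> topspace (stone_cech X)"
  shows "filter_on (topspace X) (trace_filter X p)"
proof -
  have "{} \<notin> trace_filter X p"
    unfolding trace_filter_def using stone_cech_nbhd_meets[of X] by blast
  moreover have "topspace X \<in> trace_filter X p"
    using assms by (intro trace_filterI[of X "topspace (stone_cech X)"]) auto
  moreover have "A \<inter> B \<in> trace_filter X p" if "A \<in> trace_filter X p" "B \<in> trace_filter X p" for A B
  proof -
    from that obtain U V where "openin (stone_cech X) U" "p \<in> U" "{x \<in> topspace X. stone_cech_map X x \<in> U} \<subseteq> A"
      "openin (stone_cech X) V" "p \<in> V" "{x \<in> topspace X. stone_cech_map X x \<in> V} \<subseteq> B"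
      by (auto simp: trace_filter_def)
    then show ?thesis
      using that by (intro trace_filterI[of X "U \<inter> V"]) (auto simp: trace_filter_def)
  qed
  moreover have "\<forall>A\<in>trace_filter X p. \<forall>B. A \<subseteq> B \<and> B \<subseteq> topspace X \<longrightarrow> B \<in> trace_filter X p"
    unfolding trace_filter_def by blast
  moreover have "trace_filter X p \<subseteq> Pow (topspace X)"
    by (auto simp: trace_filter_def)
  ultimately show ?thesis
    unfolding filter_on_def by blast
qed

text \<open>Take \<open>f\<close> vanishing at \<open>p\<close> and equal to 1 outside a
  neighbourhood with trace in \<open>A\<close>. The points of \<open>X\<close> with value below 1/2
  form \<open>C\<close>; allowing the value 1/2 gives \<open>Z\<close>, still inside
  \<open>A\<close>.\<close>

lemma trace_filter_base:
  assumes X: "tychonoff_space X" and A: "A \<in> trace_filter X p"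
  obtains C Z where "C \<in> trace_filter X p" "Z \<in> trace_filter X p" "cozero_set X C" "zero_set X Z"
    "C \<subseteq> Z" "Z \<subseteq> A"
proof -
  let ?b = "stone_cech X"
  let ?e = "stone_cech_map X"
  obtain U where U: "openin ?b U" "p \<in> U" "{x \<in> topspace X. ?e x \<in> U} \<subseteq> A"
    using A by (auto simp: trace_filter_def)
  then have p: "p \<in> topspace ?b"
    using openin_subset by blast
  obtain f where f: "continuous_map ?b euclideanreal f" "f p = 0" "\<And>q. q \<in> topspace ?b - U \<Longrightarrow> f q = 1"
    using stone_cech_Urysohn[OF p, of "topspace ?b - U"] U by auto
  have cont: "continuous_map X euclideanreal (\<lambda>x. f (?e x))"
    using continuous_map_compose[OF continuous_map_stone_cech_map[OF X] f(1)] by (simp add: o_def)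
  let ?C = "{x \<in> topspace X. f (?e x) < 1/2}"
  let ?Z = "{x \<in> topspace X. f (?e x) \<le> 1/2}"
  have C: "?C \<in> trace_filter X p"
  proof (rule trace_filterI)
    show "openin ?b {q \<in> topspace ?b. f q \<in> {..<1/2}}"
      using openin_continuous_map_preimage[OF f(1), of "{..<1/2}"] by simp
  qed (use p f(2) in auto)
  moreover have "?Z \<in> trace_filter X p"
    by (rule filter_onD(5)[OF filter_on_trace_filter[OF p] C]) auto
  moreover have "?Z \<subseteq> A"
  proof
    fix x
    assume "x \<in> ?Z"
    moreover from this have "?e x \<in> topspace ?b"
      using stone_cech_map_in_stone_cech[of X] by blast
    ultimately show "x \<in> A"
      using f(3)[of "?e x"] U(3) by fastforce
  qed
  moreover have "?C \<subseteq> ?Z"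
    by auto
  ultimately show thesis
    using that cozero_set_less[OF cont] zero_set_le[OF cont] by blast
qed

text \<open>A function vanishing at \<open>p\<close> and equal to \<open>1\<close> on the frontier of \<open>A\<close> may be replaced by
  \<open>1\<close> off \<open>A\<close> without losing continuity; the value at \<open>p\<close> of the extension of the new function
  decides whether \<open>A\<close> or its complement contains the trace of a neighbourhood of \<open>p\<close>.\<close>

lemma trace_filter_closedin_dichotomy:
  assumes X: "tychonoff_space X" and p: "remote_point X p" and A: "closedin X A"
  shows "A \<in> trace_filter X p \<or> topspace X - A \<in> trace_filter X p"
proof -
  let ?b = "stone_cech X"
  let ?e = "stone_cech_map X"
  have pb: "p \<in> topspace ?b"
    using p by (simp add: remote_point_def stone_cech_remainder_def)
  have "X frontier_of A \<in> NF X"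
    using nowhere_dense_in_frontier_of[OF A] by (rule nowhere_dense_in_NF)
  then obtain f where f: "continuous_map ?b euclideanreal f" "f p = 0"
    "\<And>x. x \<in> X frontier_of A \<Longrightarrow> f (?e x) = 1"
    using remote_point_separation_NF[OF X p] by metis
  \<comment> \<open>Clamping to \<open>{0..1}\<close> keeps the values at \<open>p\<close> and on
    the frontier, and makes the glued function eligible for extension.\<close>
  define k where "k q = max 0 (min 1 (f q))" for q
  have k: "continuous_map ?b euclideanreal k"
    unfolding k_def using f(1) by (intro continuous_map_real_max continuous_map_real_min) auto
  have "continuous_map X euclideanreal (\<lambda>x. k (?e x))"
    using continuous_map_compose[OF continuous_map_stone_cech_map[OF X] k] by (simp add: o_def)
  then have "continuous_map X euclideanreal (\<lambda>x. if x \<in> A then k (?e x) else 1)"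
    using f(3) by (intro continuous_map_cases continuous_map_from_subtopology) (auto simp: k_def)
  then have "continuous_map X (top_of_set {0..1}) (\<lambda>x. if x \<in> A then k (?e x) else 1)"
    by (auto simp: continuous_map_in_subtopology k_def)
  then obtain h where "continuous_map ?b (top_of_set {0..1}) h"
    and he: "\<And>x. x \<in> topspace X \<Longrightarrow> h (?e x) = (if x \<in> A then k (?e x) else 1)"
    by (rule stone_cech_extension) blast
  then have h: "continuous_map ?b euclideanreal h"
    by (simp add: continuous_map_in_subtopology)
  show ?thesis
  proof (cases "h p < 1")
    case True
    have "A \<in> trace_filter X p"
    proof (rule trace_filterI)
      show "openin ?b {q \<in> topspace ?b. h q \<in> {..<1}}"
        using openin_continuous_map_preimage[OF h, of "{..<1}"] by simp
    qed (use True pb closedin_subset[OF A] he in \<open>auto split: if_splits\<close>)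
    then show ?thesis ..
  next
    case False
    have "topspace X - A \<in> trace_filter X p"
    proof (rule trace_filterI)
      \<comment> \<open>On the image of \<open>A\<close> the functions \<open>h\<close> and
        \<open>k\<close> agree, so no point of \<open>A\<close> can have \<open>h\<close> above and
        \<open>k\<close> below 1/2; yet \<open>p\<close> satisfies both.\<close>
      show "openin ?b ({q \<in> topspace ?b. h q \<in> {1/2<..}} \<inter> {q \<in> topspace ?b. k q \<in> {..<1/2}})"
        using openin_continuous_map_preimage[OF h, of "{1/2<..}"]
          openin_continuous_map_preimage[OF k, of "{..<1/2}"] by auto
    qed (use False pb f(2) he in \<open>auto simp: k_def split: if_splits\<close>)
    then show ?thesis ..
  qed
qed

lemma remote_point_imp_zero_cozero_closed_open:
  assumes X: "tychonoff_space X" and p: "remote_point X p"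
  shows "\<exists>F. zero_cozero_closed_open_ultrafilter X F \<and> (\<nexists>x. accumulation_point X F x)"
proof (intro exI conjI)
  let ?b = "stone_cech X"
  let ?e = "stone_cech_map X"
  let ?F = "trace_filter X p"
  let ?S = "topspace X"
  have pb: "p \<in> topspace ?b" and pX: "p \<notin> ?e ` topspace X"
    using p by (auto simp: remote_point_def stone_cech_remainder_def)
  have filt: "filter_on ?S ?F"
    by (rule filter_on_trace_filter[OF pb])
  have cl: "A \<in> ?F \<or> ?S - A \<in> ?F" if "closedin X A" for A
    using trace_filter_closedin_dichotomy[OF X p that] .
  have op: "A \<in> ?F \<or> ?S - A \<in> ?F" if "openin X A" for A
    using cl[of "?S - A"] that openin_subset[OF that] by (auto simp: double_diff)
  \<comment> \<open>Leaving \<open>R\<close> general lets the base of zero sets serve for closed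
    sets too; likewise \<open>cobase\<close> serves for cozero and open sets.\<close>
  have base: "R_filter R ?S ?F" if "\<And>A. zero_set X A \<Longrightarrow> R A" for R
  proof -
    have "\<exists>Z\<in>?F. zero_set X Z \<and> Z \<subseteq> A" if "A \<in> ?F" for A
      using trace_filter_base[OF X that] by metis
    then have "filter_base ?F {A \<in> ?F. zero_set X A}"
      unfolding filter_base_def by blast
    then show ?thesis
      using filt that unfolding R_filter_def by blast
  qed
  have cobase: "R_filter R ?S ?F" if "\<And>A. cozero_set X A \<Longrightarrow> R A" for R
  proof -
    have "\<exists>C\<in>?F. cozero_set X C \<and> C \<subseteq> A" if "A \<in> ?F" for A
      using trace_filter_base[OF X that] by (metis subset_trans)
    then have "filter_base ?F {A \<in> ?F. cozero_set X A}"
      unfolding filter_base_def by blast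
    then show ?thesis
      using filt that unfolding R_filter_def by blast
  qed
  show "zero_cozero_closed_open_ultrafilter X ?F"
    unfolding zero_cozero_closed_open_ultrafilter_def R_ultrafilter_def
  proof (intro conjI allI impI)
    show "R_filter (zero_set X) ?S ?F" "R_filter (cozero_set X) ?S ?F"
      "R_filter (closedin X) ?S ?F" "R_filter (openin X) ?S ?F"
      by (intro base cobase; simp add: zero_set_imp_closedin cozero_set_imp_openin)+
  qed (auto dest: cl op zero_set_imp_closedin cozero_set_imp_openin)
  show "\<nexists>x. accumulation_point X ?F x"
  proof
    assume "\<exists>x. accumulation_point X ?F x"
    then obtain x where x: "x \<in> ?S" and acc: "\<And>A. A \<in> ?F \<Longrightarrow> x \<in> X closure_of A"
      by (auto simp: accumulation_point_def)
    have "{x} \<in> NF X"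
      using x by (simp add: finite_in_NF)
    then obtain f where f: "continuous_map ?b euclideanreal f" "f p = 0" "f (?e x) = 1"
      using remote_point_separation_NF[OF X p] by (metis singletonI)
    have cont: "continuous_map X euclideanreal (\<lambda>x. f (?e x))"
      using continuous_map_compose[OF continuous_map_stone_cech_map[OF X] f(1)] by (simp add: o_def)
    \<comment> \<open>A closed member of the filter that misses \<open>x\<close>, because
      \<open>f\<close> is 1 at the image of \<open>x\<close>.\<close>
    let ?Z = "{y \<in> ?S. f (?e y) \<le> 1/2}"
    have "?Z \<in> ?F"
    proof (rule trace_filterI)
      show "openin ?b {q \<in> topspace ?b. f q \<in> {..<1/2}}"
        using openin_continuous_map_preimage[OF f(1), of "{..<1/2}"] by simp
    qed (use pb f(2) in auto)
    moreover have "closedin X ?Z"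
      by (rule zero_set_imp_closedin[OF zero_set_le[OF cont]])
    ultimately show False
      using acc[of ?Z] f(3) by (simp add: closure_of_closedin)
  qed
qed

theorem theorem1p6:
  fixes X :: "'a topology"
  assumes "tychonoff_space X"
  shows "((\<exists>p. remote_point X p) \<longleftrightarrow>
          (\<exists>F. zero_cozero_closed_open_ultrafilter X F \<and> (\<nexists>x. accumulation_point X F x)))
       \<and> ((\<exists>F. zero_cozero_closed_open_ultrafilter X F \<and> (\<nexists>x. accumulation_point X F x)) \<longleftrightarrow>
          (\<exists>u. ultrafilter_on (topspace X) u \<and> \<not> principal_on (topspace X) u \<and>
               Op X u = Cl X u \<and> Cl X u = Zf X u \<and> Zf X u = Cz X u))
       \<and> ((\<exists>u. ultrafilter_on (topspace X) u \<and> \<not> principal_on (topspace X) u \<and>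
               Op X u = Cl X u \<and> Cl X u = Zf X u \<and> Zf X u = Cz X u) \<longleftrightarrow>
          \<not> weakly_compact_wrt (NF X) X)"
proof -
  have t1: "t1_space X"
    using assms by (simp add: tychonoff_space_def Hausdorff_imp_t1_space)
  have ab: "(\<exists>p. remote_point X p) \<longleftrightarrow>
      (\<exists>F. zero_cozero_closed_open_ultrafilter X F \<and> (\<nexists>x. accumulation_point X F x))"
    using remote_point_imp_zero_cozero_closed_open[OF assms]
      zero_cozero_closed_open_imp_remote_point[OF assms] by blast
  moreover have bc: "(\<exists>F. zero_cozero_closed_open_ultrafilter X F \<and> (\<nexists>x. accumulation_point X F x)) \<longleftrightarrow>
      (\<exists>u. ultrafilter_on (topspace X) u \<and> \<not> principal_on (topspace X) u \<and>
           Op X u = Cl X u \<and> Cl X u = Zf X u \<and> Zf X u = Cz X u)"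
    using ultrafilter_of_zero_cozero_closed_open zero_cozero_closed_open_of_ultrafilter[OF t1]
    by (intro iffI; elim exE conjE)
  moreover have "(\<exists>p. remote_point X p) \<longleftrightarrow> \<not> weakly_compact_wrt (NF X) X"
    using remote_point_imp_not_weakly_compact[OF assms]
      not_weakly_compact_imp_remote_point[OF assms] by blast
  ultimately show ?thesis
    by simp
qed

end
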